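(* Let $d\ge2$ be an integer, $a>0$ a constant, fix constants $\epsilon,\tau>0$ independent of $n$, and let $n$ be such that $n^{1/d}$ is an integer. Place $n$ sensors in $[0,\infty)^d$ as follows: take $d$ independent homogeneous Poisson processes on $[0,\infty)$, each with rate $n^{1/d}$, let $X^{(j)}_1<\dots<X^{(j)}_{n^{1/d}}$ be the first $n^{1/d}$ arrival times of the $j$-th process, and put one sensor at each point $(X^{(1)}_{i_1},\dots,X^{(d)}_{i_d})$, $1\le i_1,\dots,i_d\le n^{1/d}$. Let $s=\frac{1-\epsilon}{n^{1/d}}$, $v=\frac{1+\tau}{n^{1/d}}$, and consider algorithm $I_d(n,s,v)$: for each axis-parallel line ("row or column") of $n^{1/d}$ sensors, apply to the sensors of that line, along its direction, the one-dimensional algorithm $I_1(n^{1/d},s,v)$, which processes the sensors of the line in increasing order of their coordinate $Y_1\le\dots\le Y_{m}$ ($m=n^{1/d}$) and, for $i=2,\dots,m$ in turn, with $Y_{i-1}$ the current (possibly already moved) position of the previous sensor, moves sensor $i$ to $Y_{i-1}+s$ if $Y_i-Y_{i-1}<s$, to $Y_{i-1}+v$ if $Y_i-Y_{i-1}>v$, and leaves it in place otherwise. Then the expected $d$-dimensional $a$-total movement of $I_d(n,s,v)$ is $O\!\left(n^{1-\frac{a}{d}}\right)$.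
   Context: If a sensor $S_i$ at $(y_1(i),\dots,y_d(i))$ is moved to $(y_1(i)+m_1(i),\dots,y_d(i)+m_d(i))$, the $d$-dimensional $a$-total movement is $\sum_{i=1}^n\sum_{j=1}^d|m_j(i)|^a$. Asymptotics are as $n\to\infty$ with $a,d,\epsilon,\tau$ fixed. *)

theory Defs
  imports
    "HOL-Probability.Probability"
    "HOL-Computational_Algebra.Nth_Powers"
    "HOL-Library.Landau_Symbols"
    "HOL-Library.FuncSet"
begin

(* All indices are zero-based: T 0 is the first arrival time, sensor 0 the first sensor of a line. *)

definition interarrival :: "(nat \<Rightarrow> 'w \<Rightarrow> real) \<Rightarrow> nat \<Rightarrow> 'w \<Rightarrow> real" where
  "interarrival T k \<omega> = (case k of 0 \<Rightarrow> T 0 \<omega> | Suc l \<Rightarrow> T (Suc l) \<omega> - T l \<omega>)"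

(* A homogeneous Poisson process of rate r on [0, \<infinity>), given by its sequence of arrival times:
   the waiting times between consecutive arrivals (starting from time 0) are i.i.d.
   exponential with parameter r. In particular the arrival times are almost surely positive
   and strictly increasing. *)
definition poisson_process :: "'w measure \<Rightarrow> real \<Rightarrow> (nat \<Rightarrow> 'w \<Rightarrow> real) \<Rightarrow> bool" where
  "poisson_process M r T \<longleftrightarrow>
     prob_space.indep_vars M (\<lambda>_. borel) (interarrival T) UNIV \<and>
     (\<forall>k. distributed M lborel (interarrival T k) (exponential_density r))"

(* X j k is the k-th arrival time of process j. Independence is that of whole processes,
   i.e. of the sequence-valued random variables (X j 0, X j 1, ...), j < d. *)
definition independent_poisson_processes ::
    "'w measure \<Rightarrow> nat \<Rightarrow> real \<Rightarrow> (nat \<Rightarrow> nat \<Rightarrow> 'w \<Rightarrow> real) \<Rightarrow> bool" where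
  "independent_poisson_processes M d r X \<longleftrightarrow>
     prob_space M \<and>
     (\<forall>j<d. poisson_process M r (X j)) \<and>
     prob_space.indep_vars M (\<lambda>_. Pi\<^sub>M UNIV (\<lambda>_. borel)) (\<lambda>j \<omega> k. X j k \<omega>) {..<d}"

(* A placement assigns to each sensor, named by its multi-index i, its coordinates P i j, j < d. *)
type_synonym placement = "(nat \<Rightarrow> nat) \<Rightarrow> nat \<Rightarrow> real"

definition sensors :: "nat \<Rightarrow> nat \<Rightarrow> (nat \<Rightarrow> nat) set" where
  "sensors d m = {..<d} \<rightarrow>\<^sub>E {..<m}"

definition initial_placement :: "(nat \<Rightarrow> nat \<Rightarrow> 'w \<Rightarrow> real) \<Rightarrow> 'w \<Rightarrow> placement" where
  "initial_placement X \<omega> = (\<lambda>i j. X j (i j) \<omega>)"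

(* Y lists the initial positions on a line in increasing order; line_algorithm s v Y k is the
   final position of sensor k. The number m of sensors is not a parameter, since the position
   of sensor k only depends on the sensors before it. *)
primrec line_algorithm :: "real \<Rightarrow> real \<Rightarrow> (nat \<Rightarrow> real) \<Rightarrow> nat \<Rightarrow> real" where
  "line_algorithm s v Y 0 = Y 0"
| "line_algorithm s v Y (Suc k) =
     (let z = line_algorithm s v Y k in
        if Y (Suc k) - z < s then z + s
        else if Y (Suc k) - z > v then z + v
        else Y (Suc k))"

(* The line through sensor i in direction j consists of the sensors i(j := k), k < m. On a
   placement whose j-th coordinates are increasing in k, as for the arrival times, the index
   order is the order in which the sensors are to be processed. Only j-th coordinates change. *)
definition process_direction :: "real \<Rightarrow> real \<Rightarrow> nat \<Rightarrow> placement \<Rightarrow> placement" where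
  "process_direction s v j P =
     (\<lambda>i. (P i)(j := line_algorithm s v (\<lambda>k. P (i(j := k)) j) (i j)))"

definition grid_algorithm :: "nat \<Rightarrow> real \<Rightarrow> real \<Rightarrow> placement \<Rightarrow> placement" where
  "grid_algorithm d s v P = fold (process_direction s v) [0..<d] P"

definition total_movement :: "nat \<Rightarrow> nat \<Rightarrow> real \<Rightarrow> placement \<Rightarrow> placement \<Rightarrow> real" where
  "total_movement d m a P Q = (\<Sum>i\<in>sensors d m. \<Sum>j<d. \<bar>Q i j - P i j\<bar> powr a)"

(* Only used when n is a perfect d-th power, where nth_root_nat d n is exactly n^(1/d). *)
definition algorithm_movement ::
    "nat \<Rightarrow> real \<Rightarrow> real \<Rightarrow> real \<Rightarrow> nat \<Rightarrow> (nat \<Rightarrow> nat \<Rightarrow> 'w \<Rightarrow> real) \<Rightarrow> 'w \<Rightarrow> real" where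
  "algorithm_movement d a \<epsilon> \<tau> n X \<omega> =
     (let m = nth_root_nat d n; s = (1 - \<epsilon>) / real m; v = (1 + \<tau>) / real m;
          P = initial_placement X \<omega>
      in total_movement d m a P (grid_algorithm d s v P))"

end

theory Submission
  imports Defs
begin

text \<open>The displacement \<open>D\<close> of the sensors along a line satisfies
  \<open>D' = max 0 (D + s - g) - max 0 (g - v - D)\<close>, where \<open>g\<close> is the next waiting time. Its positive and
  negative parts are therefore dominated by random walks reflected at \<open>0\<close>, with increments
  \<open>s - g\<close> and \<open>g - v\<close> of mean \<open>-\<epsilon>/m\<close> and \<open>-\<tau>/m\<close>. As the drifts are negative and \<open>g\<close> has exponential
  moments, there is a constant \<open>\<theta> > 0\<close> such that \<open>exp (\<theta> m \<bar>D\<bar>)\<close> has bounded expectation, uniformly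
  in \<open>m\<close> and in the position on the line, so the \<open>a\<close>-th moment of \<open>D\<close> is \<open>O(m powr - a)\<close>. Finally,
  directions do not interact: processing direction \<open>j\<close> moves each point of the grid in the same way
  as the arrival with the same index in process \<open>j\<close>.\<close>

section \<open>Perpetuities and their expectations\<close>

text \<open>The exponential of a random walk reflected at 0 is the maximum of the products summed
  here. Passing from the maximum to the sum keeps an upper bound and makes the expectation
  accessible through independence.\<close>

definition perpetuity :: "(nat \<Rightarrow> 'a::comm_semiring_1) \<Rightarrow> nat \<Rightarrow> 'a" where
  "perpetuity z k = (\<Sum>j\<le>k. \<Prod>i\<in>{Suc j..k}. z i)"

lemma perpetuity_0 [simp]: "perpetuity z 0 = 1"
  by (simp add: perpetuity_def)

lemma perpetuity_Suc: "perpetuity z (Suc k) = 1 + z (Suc k) * perpetuity z k"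
proof -
  have "(\<Sum>j\<le>k. \<Prod>i\<in>{Suc j..Suc k}. z i) = (\<Sum>j\<le>k. z (Suc k) * (\<Prod>i\<in>{Suc j..k}. z i))"
    by (intro sum.cong refl) (simp add: atLeastAtMostSuc_conv)
  then show ?thesis
    by (simp add: perpetuity_def sum_distrib_left add.commute)
qed

lemma perpetuity_nonneg:
  fixes z :: "nat \<Rightarrow> real"
  assumes "\<And>k. 0 \<le> z k"
  shows "0 \<le> perpetuity z k"
  using assms by (auto simp: perpetuity_def intro!: sum_nonneg prod_nonneg)

text \<open>By independence the product of the last \<open>k - j\<close> factors has mean at most
  \<open>\<rho> ^ (k - j)\<close>. The geometric series then gives a bound uniform in
  \<open>k\<close>.\<close>

lemma (in prob_space) perpetuity_expectation:
  fixes Z :: "nat \<Rightarrow> 'a \<Rightarrow> real"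
  assumes ind: "indep_vars (\<lambda>_. borel) Z UNIV"
    and int: "\<And>k. integrable M (Z k)"
    and Z0: "\<And>k \<omega>. 0 \<le> Z k \<omega>"
    and le: "\<And>k. expectation (Z k) \<le> \<rho>" and "\<rho> < 1"
  shows "integrable M (\<lambda>\<omega>. perpetuity (\<lambda>k. Z k \<omega>) k)"
    and "expectation (\<lambda>\<omega>. perpetuity (\<lambda>k. Z k \<omega>) k) \<le> 1 / (1 - \<rho>)"
proof -
  have "0 \<le> expectation (Z 0)"
    using Z0 by (intro integral_nonneg_AE) auto
  with le[of 0] have \<rho>0: "0 \<le> \<rho>" by linarith
  have prod: "integrable M (\<lambda>\<omega>. \<Prod>i\<in>{Suc j..k}. Z i \<omega>) \<and>
      expectation (\<lambda>\<omega>. \<Prod>i\<in>{Suc j..k}. Z i \<omega>) \<le> \<rho> ^ (k - j)" for j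
  proof (cases "j < k")
    \<comment> \<open>The product is empty and the truncated difference \<open>k - j\<close> is 0,
      so both sides are 1.\<close>
    case False
    then show ?thesis by (simp add: prob_space)
  next
    case True
    have ind': "indep_vars (\<lambda>_. borel) Z {Suc j..k}"
      by (rule indep_vars_subset[OF ind]) auto
    have "expectation (\<lambda>\<omega>. \<Prod>i\<in>{Suc j..k}. Z i \<omega>) = (\<Prod>i\<in>{Suc j..k}. expectation (Z i))"
      by (rule indep_vars_lebesgue_integral[OF _ ind' int]) auto
    also have "\<dots> \<le> (\<Prod>i\<in>{Suc j..k}. \<rho>)"
      using Z0 le by (intro prod_mono) (auto intro!: integral_nonneg_AE)
    finally show ?thesis
      using indep_vars_integrable[OF _ ind' int] by simp
  qed
  show "integrable M (\<lambda>\<omega>. perpetuity (\<lambda>k. Z k \<omega>) k)"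
    unfolding perpetuity_def using prod by (intro Bochner_Integration.integrable_sum) auto
  have "expectation (\<lambda>\<omega>. perpetuity (\<lambda>k. Z k \<omega>) k)
      = (\<Sum>j\<le>k. expectation (\<lambda>\<omega>. \<Prod>i\<in>{Suc j..k}. Z i \<omega>))"
    unfolding perpetuity_def using prod by (intro Bochner_Integration.integral_sum) auto
  also have "\<dots> \<le> (\<Sum>j\<le>k. \<rho> ^ (k - j))"
    using prod by (intro sum_mono) auto
  also have "\<dots> = (\<Sum>j\<le>k. \<rho> ^ j)"
    by (rule sum.reindex_bij_witness[where i="\<lambda>j. k - j" and j="\<lambda>j. k - j"]) auto
  also have "\<dots> = (1 - \<rho> ^ Suc k) / (1 - \<rho>)"
    using \<open>\<rho> < 1\<close> by (simp add: sum_gp0)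
  also have "\<dots> \<le> 1 / (1 - \<rho>)"
    using \<open>\<rho> < 1\<close> \<rho>0 by (intro divide_right_mono) auto
  finally show "expectation (\<lambda>\<omega>. perpetuity (\<lambda>k. Z k \<omega>) k) \<le> 1 / (1 - \<rho>)" .
qed

section \<open>Pathwise exponential bounds on the displacement\<close>

text \<open>A push to the right adds \<open>s\<close> minus the gap to the displacement, which
  multiplies its exponential by the next factor. Otherwise the sensor stays or moves back, and the
  summand 1 of the recursion suffices.\<close>

lemma exp_displacement_le:
  assumes "t > 0"
  shows "exp (t * (line_algorithm s v Y k - Y k))
    \<le> perpetuity (\<lambda>i. exp (t * (s - (Y i - Y (i - 1))))) k"
proof (induction k)
  case (Suc k)
  let ?z = "\<lambda>i. exp (t * (s - (Y i - Y (i - 1))))"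
  let ?D = "\<lambda>k. line_algorithm s v Y k - Y k"
  show ?case
  proof (cases "Y (Suc k) - line_algorithm s v Y k < s")
    case True
    then have "exp (t * ?D (Suc k)) = ?z (Suc k) * exp (t * ?D k)"
      by (simp add: Let_def flip: exp_add) (simp add: algebra_simps)
    also have "\<dots> \<le> ?z (Suc k) * perpetuity ?z k"
      using Suc by (intro mult_left_mono) auto
    finally show ?thesis by (simp add: perpetuity_Suc)
  next
    case False
    then have "?D (Suc k) \<le> 0" by (simp add: Let_def)
    then have "exp (t * ?D (Suc k)) \<le> 1"
      using assms by (simp add: mult_nonneg_nonpos)
    also have "1 \<le> perpetuity ?z (Suc k)"
      by (simp add: perpetuity_Suc perpetuity_nonneg)
    finally show ?thesis .
  qed
qed simp

lemma exp_neg_displacement_le: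
  assumes "t > 0"
  shows "exp (- t * (line_algorithm s v Y k - Y k))
    \<le> perpetuity (\<lambda>i. exp (t * (Y i - Y (i - 1) - v))) k"
proof (induction k)
  case (Suc k)
  let ?z = "\<lambda>i. exp (t * (Y i - Y (i - 1) - v))"
  let ?D = "\<lambda>k. line_algorithm s v Y k - Y k"
  show ?case
  \<comment> \<open>The test against \<open>s\<close> comes first in \<open>line_algorithm\<close>,
    so a move by the rule for \<open>v\<close> requires that test to fail.\<close>
  proof (cases "Y (Suc k) - line_algorithm s v Y k > v \<and> \<not> Y (Suc k) - line_algorithm s v Y k < s")
    case True
    then have "exp (- t * ?D (Suc k)) = ?z (Suc k) * exp (- t * ?D k)"
      by (simp add: Let_def flip: exp_add) (simp add: algebra_simps)
    also have "\<dots> \<le> ?z (Suc k) * perpetuity ?z k"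
      using Suc by (intro mult_left_mono) auto
    finally show ?thesis by (simp add: perpetuity_Suc)
  next
    case False
    then have "?D (Suc k) \<ge> 0" by (auto simp: Let_def)
    then have "exp (- t * ?D (Suc k)) \<le> 1"
      using assms by simp
    also have "1 \<le> perpetuity ?z (Suc k)"
      by (simp add: perpetuity_Suc perpetuity_nonneg)
    finally show ?thesis .
  qed
qed simp

section \<open>Powers against exponentials, and the exponential law\<close>

text \<open>This is \<open>y \<le> exp y\<close> at \<open>y = t * x / a\<close>, raised to the
  power \<open>a\<close>.\<close>

lemma powr_le_exp:
  fixes x a t :: real
  assumes "x \<ge> 0" "a > 0" "t > 0"
  shows "x powr a \<le> (a / t) powr a * exp (t * x)"
proof -
  have "x powr a = (a / t * (t * x / a)) powr a"
    using assms by simp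
  also have "\<dots> = (a / t) powr a * (t * x / a) powr a"
    by (rule powr_mult)
  also have "\<dots> \<le> (a / t) powr a * exp (t * x / a) powr a"
    using assms by (intro mult_left_mono powr_mono2 less_imp_le[OF exp_gt_self]) auto
  also have "exp (t * x / a) powr a = exp (t * x)"
    using assms by (simp add: powr_def)
  finally show ?thesis .
qed

text \<open>Exponential tilting: multiplying the density by \<open>exp (t * x)\<close> gives a
  multiple of the exponential density of rate \<open>r - t\<close>. The latter has total mass 1, so
  the multiple is the expectation.\<close>

lemma (in prob_space) exponential_mgf:
  assumes D: "distributed M lborel G (exponential_density r)" and "0 < r" "t < r"
  shows "integrable M (\<lambda>\<omega>. exp (t * G \<omega>))"
    and "expectation (\<lambda>\<omega>. exp (t * G \<omega>)) = r / (r - t)"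
proof -
  have eq: "exponential_density r x * exp (t * x) = r / (r - t) * exponential_density (r - t) x" for x
  proof -
    have "exp (- x * r) * exp (t * x) = exp (- x * (r - t))"
      by (simp add: algebra_simps flip: exp_add)
    then show ?thesis
      using \<open>t < r\<close> by (simp add: exponential_density_def)
  qed
  interpret E: prob_space "density lborel (exponential_density (r - t))"
    using \<open>t < r\<close> by (intro prob_space_exponential_density) simp
  have nn: "0 \<le> exponential_density u x" if "0 < u" for u x :: real
    using that by (simp add: exponential_density_nonneg)
  have "integrable (density lborel (exponential_density (r - t))) (\<lambda>_. 1 :: real)"
    by simp
  then have int: "integrable lborel (exponential_density (r - t))"
    using \<open>t < r\<close> by (subst (asm) integrable_density) (auto simp: nn)
  have "integral\<^sup>L (density lborel (exponential_density (r - t))) (\<lambda>_. 1 :: real) = 1"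
    using E.prob_space by simp
  then have one: "integral\<^sup>L lborel (exponential_density (r - t)) = 1"
    using \<open>t < r\<close> by (subst (asm) integral_density) (auto simp: nn)
  show "integrable M (\<lambda>\<omega>. exp (t * G \<omega>))"
    using int distributed_integrable[OF D, of "\<lambda>x. exp (t * x)"] \<open>0 < r\<close> by (simp add: eq nn)
  show "expectation (\<lambda>\<omega>. exp (t * G \<omega>)) = r / (r - t)"
    using one distributed_integral[OF D, of "\<lambda>x. exp (t * x)"] \<open>0 < r\<close> by (simp add: eq nn)
qed

section \<open>Reduction of the grid to independent lines\<close>

text \<open>In a product grid, coordinate \<open>l\<close> depends only on index \<open>l\<close>.
  All lines in direction \<open>j\<close> therefore carry the same positions \<open>F j\<close> and
  are moved alike, so the result is again a product grid.\<close>

lemma process_direction_separable: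
  "process_direction s v j (\<lambda>i l. F l (i l)) =
    (\<lambda>i l. (F(j := line_algorithm s v (F j))) l (i l))"
  by (auto simp: process_direction_def fun_eq_iff)

lemma fold_process_direction:
  assumes "distinct js"
  shows "fold (process_direction s v) js (\<lambda>i l. F l (i l)) =
    (\<lambda>i l. if l \<in> set js then line_algorithm s v (F l) (i l) else F l (i l))"
  using assms
proof (induction js arbitrary: F)
  case (Cons j js)
  then show ?case
    by (simp add: process_direction_separable del: fun_upd_apply) (auto simp: fun_eq_iff)
qed simp

lemma grid_algorithm_initial_placement:
  assumes "j < d"
  shows "grid_algorithm d s v (initial_placement X \<omega>) i j
    = line_algorithm s v (\<lambda>k. X j k \<omega>) (i j)"
  using fold_process_direction[of "[0..<d]" s v "\<lambda>j k. X j k \<omega>"] assms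
  by (simp add: grid_algorithm_def initial_placement_def)

section \<open>Measurability and the moments of one displacement\<close>

lemma interarrival_measurable_imp_measurable:
  assumes "\<And>k. interarrival T k \<in> borel_measurable M"
  shows "T k \<in> borel_measurable M"
proof (induction k)
  case 0
  show ?case
    using assms[of 0] by (simp add: interarrival_def[abs_def])
next
  case (Suc k)
  have "T (Suc k) = (\<lambda>\<omega>. interarrival T (Suc k) \<omega> + T k \<omega>)"
    by (simp add: interarrival_def fun_eq_iff)
  then show ?case
    using assms[of "Suc k"] Suc by simp
qed

lemma line_algorithm_measurable:
  assumes [measurable]: "\<And>k. T k \<in> borel_measurable M"
  shows "(\<lambda>\<omega>. line_algorithm s v (\<lambda>k. T k \<omega>) k) \<in> borel_measurable M"
proof (induction k)
  case (Suc k)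
  note [measurable] = this
  show ?case by (simp add: Let_def)
qed simp

text \<open>Summand \<open>0\<close> of the sequence \<open>z\<close> does not enter \<open>perpetuity z\<close>, so the junk waiting time
  \<open>Y 0 - Y (0 - 1) = 0\<close> of the displacement bounds may be replaced by the first interarrival time.\<close>

lemma perpetuity_cong:
  assumes "\<And>i. i > 0 \<Longrightarrow> z i = z' i"
  shows "perpetuity z k = perpetuity z' k"
  using assms by (auto simp: perpetuity_def intro!: sum.cong prod.cong)

lemma interarrival_pos: "i > 0 \<Longrightarrow> interarrival T i \<omega> = T i \<omega> - T (i - 1) \<omega>"
  by (cases i) (auto simp: interarrival_def)

text \<open>The perpetuities have expectations bounded uniformly in \<open>k\<close> and
  \<open>r\<close>. Comparing the power with an exponential of rate proportional to \<open>r\<close>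
  leaves \<open>r powr - a\<close> as the only dependence on \<open>r\<close>.\<close>

lemma (in prob_space) poisson_displacement_moment:
  fixes k :: nat
  assumes pp: "poisson_process M r T" and "0 < r" and "a > 0"
    and \<theta>: "0 < \<theta>" "\<theta> < 1"
    and \<rho>: "exp (\<theta> * \<sigma>) / (1 + \<theta>) \<le> \<rho>" "exp (- \<theta> * \<eta>) / (1 - \<theta>) \<le> \<rho>" "\<rho> < 1"
  defines "D \<equiv> \<lambda>\<omega>. \<bar>line_algorithm (\<sigma> / r) (\<eta> / r) (\<lambda>k. T k \<omega>) k - T k \<omega>\<bar> powr a"
  shows "integrable M D"
    and "expectation D \<le> 2 * (a / \<theta>) powr a / (1 - \<rho>) * r powr - a"
proof -
  \<comment> \<open>Waiting times have scale \<open>1 / r\<close>. With this \<open>t\<close> the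
    means of \<open>Z\<close> and \<open>Z'\<close> below are exactly the quotients bounded by
    \<open>\<rho>\<close>, free of \<open>r\<close>.\<close>
  define t where "t = \<theta> * r"
  have t: "0 < t" "t < r" "- t < r"
    using \<theta> \<open>0 < r\<close> by (auto simp: t_def intro: less_trans[of _ 0])
  have ind: "indep_vars (\<lambda>_. borel) (interarrival T) UNIV"
    and dist: "\<And>k. distributed M lborel (interarrival T k) (exponential_density r)"
    using pp by (auto simp: poisson_process_def)
  have meas: "interarrival T k \<in> borel_measurable M" for k
    using distributed_measurable[OF dist[of k]] by simp
  note [measurable] = interarrival_measurable_imp_measurable[OF meas]
    line_algorithm_measurable[OF interarrival_measurable_imp_measurable[OF meas]]
  \<comment> \<open>\<open>Z\<close> and \<open>Z'\<close> are the factors of the perpetuities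
    dominating displacement to the right and to the left.\<close>
  define Z where "Z k \<omega> = exp (t * (\<sigma> / r - interarrival T k \<omega>))" for k \<omega>
  define Z' where "Z' k \<omega> = exp (t * (interarrival T k \<omega> - \<eta> / r))" for k \<omega>
  have Z_eq: "Z k = (\<lambda>\<omega>. exp (\<theta> * \<sigma>) * exp (- t * interarrival T k \<omega>))" for k
    using \<open>0 < r\<close> by (simp add: Z_def fun_eq_iff t_def algebra_simps flip: exp_add)
  have Z'_eq: "Z' k = (\<lambda>\<omega>. exp (- \<theta> * \<eta>) * exp (t * interarrival T k \<omega>))" for k
    using \<open>0 < r\<close> by (simp add: Z'_def fun_eq_iff t_def algebra_simps flip: exp_add)
  have r_t: "r / (r - - t) = 1 / (1 + \<theta>)" "r / (r - t) = 1 / (1 - \<theta>)"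
    using \<theta> \<open>0 < r\<close> t by (auto simp: t_def field_simps)
  have Z_ind: "indep_vars (\<lambda>_. borel) Z UNIV"
    unfolding Z_def[abs_def] by (rule indep_vars_compose2[OF ind]) simp
  have Z'_ind: "indep_vars (\<lambda>_. borel) Z' UNIV"
    unfolding Z'_def[abs_def] by (rule indep_vars_compose2[OF ind]) simp
  have Z_int: "integrable M (Z k)" for k
    unfolding Z_eq using exponential_mgf(1)[OF dist \<open>0 < r\<close> t(3)] by simp
  have Z'_int: "integrable M (Z' k)" for k
    unfolding Z'_eq using exponential_mgf(1)[OF dist \<open>0 < r\<close> t(2)] by simp
  have Z_le: "expectation (Z k) \<le> \<rho>" for k
    unfolding Z_eq using exponential_mgf(2)[OF dist \<open>0 < r\<close> t(3)] \<rho>(1) r_t(1) by simp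
  have Z'_le: "expectation (Z' k) \<le> \<rho>" for k
    unfolding Z'_eq using exponential_mgf(2)[OF dist \<open>0 < r\<close> t(2)] \<rho>(2) r_t(2) by simp
  have Z_nn: "0 \<le> Z k \<omega>" "0 \<le> Z' k \<omega>" for k \<omega>
    by (auto simp: Z_def Z'_def)
  note E = perpetuity_expectation[OF Z_ind Z_int Z_nn(1) Z_le \<rho>(3), of k]
  note E' = perpetuity_expectation[OF Z'_ind Z'_int Z_nn(2) Z'_le \<rho>(3), of k]
  \<comment> \<open>The sum of the two perpetuities covers both signs of the displacement, since
    \<open>exp (t * \<bar>x\<bar>)\<close> is one of \<open>exp (t * x)\<close> and
    \<open>exp (- t * x)\<close>.\<close>
  define B where
    "B \<omega> = (a / t) powr a * (perpetuity (\<lambda>k. Z k \<omega>) k + perpetuity (\<lambda>k. Z' k \<omega>) k)" for \<omega>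
  have B_int: "integrable M B"
    unfolding B_def[abs_def] using E(1) E'(1) by simp
  have D_le_B: "D \<omega> \<le> B \<omega>" for \<omega>
  proof -
    define x where "x = line_algorithm (\<sigma> / r) (\<eta> / r) (\<lambda>k. T k \<omega>) k - T k \<omega>"
    have "exp (t * x) \<le> perpetuity (\<lambda>k. Z k \<omega>) k"
      unfolding x_def
      using exp_displacement_le[OF t(1), where Y="\<lambda>k. T k \<omega>"]
      by (rule order_trans) (auto intro!: eq_refl perpetuity_cong simp: Z_def interarrival_pos)
    moreover have "exp (- t * x) \<le> perpetuity (\<lambda>k. Z' k \<omega>) k"
      unfolding x_def
      using exp_neg_displacement_le[OF t(1), where Y="\<lambda>k. T k \<omega>"]
      by (rule order_trans) (auto intro!: eq_refl perpetuity_cong simp: Z'_def interarrival_pos)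
    moreover have "exp (t * \<bar>x\<bar>) \<le> exp (t * x) + exp (- t * x)"
      by (cases "x \<ge> 0") auto
    ultimately have "exp (t * \<bar>x\<bar>) \<le> perpetuity (\<lambda>k. Z k \<omega>) k + perpetuity (\<lambda>k. Z' k \<omega>) k"
      by linarith
    then have "(a / t) powr a * exp (t * \<bar>x\<bar>) \<le> B \<omega>"
      unfolding B_def by (intro mult_left_mono) auto
    then show ?thesis
      using powr_le_exp[of "\<bar>x\<bar>" a t] \<open>a > 0\<close> t(1) by (simp add: D_def x_def)
  qed
  have D_nn: "0 \<le> D \<omega>" for \<omega> by (simp add: D_def)
  show D_int: "integrable M D"
  proof (rule Bochner_Integration.integrable_bound[OF B_int])
    show "D \<in> borel_measurable M" unfolding D_def by measurable
    have "norm (D \<omega>) \<le> norm (B \<omega>)" for \<omega>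
      using D_le_B[of \<omega>] D_nn[of \<omega>] by simp
    then show "AE \<omega> in M. norm (D \<omega>) \<le> norm (B \<omega>)" by simp
  qed
  have "expectation D \<le> expectation B"
    using D_int B_int D_le_B by (intro integral_mono) auto
  also have "expectation B = (a / t) powr a *
      (expectation (\<lambda>\<omega>. perpetuity (\<lambda>k. Z k \<omega>) k) + expectation (\<lambda>\<omega>. perpetuity (\<lambda>k. Z' k \<omega>) k))"
    unfolding B_def using E(1) E'(1) by simp
  also have "\<dots> \<le> (a / t) powr a * (1 / (1 - \<rho>) + 1 / (1 - \<rho>))"
    using E(2) E'(2) by (intro mult_left_mono add_mono) auto
  also have "(a / t) powr a = (a / \<theta>) powr a * r powr - a"
    using \<open>a > 0\<close> \<theta> \<open>0 < r\<close> by (simp add: t_def powr_divide powr_mult powr_minus_divide)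
  finally show "expectation D \<le> 2 * (a / \<theta>) powr a / (1 - \<rho>) * r powr - a"
    by (simp add: algebra_simps)
qed

section \<open>Choice of constants and the bound for the whole grid\<close>

text \<open>As functions of \<open>\<theta>\<close>, both quotients equal 1 at 0 and have
  derivatives \<open>- \<epsilon>\<close> and \<open>- \<tau>\<close> there, so a small positive
  \<open>\<theta>\<close> brings both below 1.\<close>

lemma negative_drift_constants:
  assumes "\<epsilon> > 0" "\<tau> > 0"
  obtains \<theta> \<rho> :: real where "0 < \<theta>" "\<theta> < 1" "\<rho> < 1"
    "exp (\<theta> * (1 - \<epsilon>)) / (1 + \<theta>) \<le> \<rho>" "exp (- \<theta> * (1 + \<tau>)) / (1 - \<theta>) \<le> \<rho>"
proof -
  \<comment> \<open>For \<open>\<theta> \<le> 1 / 2\<close>, the logarithms are at least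
    \<open>\<theta> - \<theta>\<^sup>2\<close> and \<open>- \<theta> - 2 * \<theta>\<^sup>2\<close>.
    The other two bounds keep these quadratic losses below the gains
    \<open>\<theta> * \<epsilon>\<close> and \<open>\<theta> * \<tau>\<close>.\<close>
  define \<theta> where "\<theta> = min (1 / 2) (min (\<epsilon> / 2) (\<tau> / 4))"
  have \<theta>: "0 < \<theta>" "\<theta> \<le> 1 / 2" "\<theta> < \<epsilon>" "2 * \<theta> < \<tau>"
    using assms by (auto simp: \<theta>_def min_def)
  have "\<theta> * (1 - \<epsilon>) = \<theta> - \<theta> * \<epsilon>" "- \<theta> * (1 + \<tau>) = - \<theta> - \<theta> * \<tau>"
    by (simp_all add: algebra_simps)
  moreover have "\<theta>\<^sup>2 < \<theta> * \<epsilon>" "2 * \<theta>\<^sup>2 < \<theta> * \<tau>"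
    using \<theta> by (simp_all add: power2_eq_square)
  ultimately have "\<theta> * (1 - \<epsilon>) < ln (1 + \<theta>)" "- \<theta> * (1 + \<tau>) < ln (1 - \<theta>)"
    using ln_one_plus_pos_lower_bound[of \<theta>] ln_one_minus_pos_lower_bound[of \<theta>] \<theta>
    by linarith+
  then have "exp (\<theta> * (1 - \<epsilon>)) < exp (ln (1 + \<theta>))" "exp (- \<theta> * (1 + \<tau>)) < exp (ln (1 - \<theta>))"
    by (simp_all only: exp_less_mono)
  then have "exp (\<theta> * (1 - \<epsilon>)) / (1 + \<theta>) < 1" "exp (- \<theta> * (1 + \<tau>)) / (1 - \<theta>) < 1"
    using \<theta> by simp_all
  then show thesis
    using \<theta> that[of \<theta> "max (exp (\<theta> * (1 - \<epsilon>)) / (1 + \<theta>)) (exp (- \<theta> * (1 + \<tau>)) / (1 - \<theta>))"]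
    by auto
qed

theorem theorem12:
  fixes d :: nat and a \<epsilon> \<tau> :: real
    and M :: "nat \<Rightarrow> 'w measure" and X :: "nat \<Rightarrow> nat \<Rightarrow> nat \<Rightarrow> 'w \<Rightarrow> real"
  assumes "d \<ge> 2" and "a > 0" and "\<epsilon> > 0" and "\<tau> > 0"
    and "\<And>n. n > 0 \<Longrightarrow> is_nth_power d n \<Longrightarrow>
           independent_poisson_processes (M n) d (real (nth_root_nat d n)) (X n)"
  shows "(\<forall>n>0. is_nth_power d n \<longrightarrow>
            integrable (M n) (algorithm_movement d a \<epsilon> \<tau> n (X n))) \<and>
         (\<lambda>n. integral\<^sup>L (M n) (algorithm_movement d a \<epsilon> \<tau> n (X n)))
           \<in> O[inf sequentially (principal {n. is_nth_power d n})](\<lambda>n. real n powr (1 - a / real d))"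
proof -
  obtain \<theta> \<rho> where c: "0 < \<theta>" "\<theta> < 1" "\<rho> < 1"
    "exp (\<theta> * (1 - \<epsilon>)) / (1 + \<theta>) \<le> \<rho>" "exp (- \<theta> * (1 + \<tau>)) / (1 - \<theta>) \<le> \<rho>"
    using negative_drift_constants[OF \<open>\<epsilon> > 0\<close> \<open>\<tau> > 0\<close>] .
  define C where "C = 2 * (a / \<theta>) powr a / (1 - \<rho>)"
  \<comment> \<open>The bound holds for every positive perfect power, with one constant.
    Nonnegativity is carried along to remove the norm in the Landau bound.\<close>
  have main: "integrable (M n) (algorithm_movement d a \<epsilon> \<tau> n (X n)) \<and>
      0 \<le> integral\<^sup>L (M n) (algorithm_movement d a \<epsilon> \<tau> n (X n)) \<and>
      integral\<^sup>L (M n) (algorithm_movement d a \<epsilon> \<tau> n (X n)) \<le> real d * C * real n powr (1 - a / real d)"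
    if n: "n > 0" "is_nth_power d n" for n
  proof -
    obtain m where m: "n = m ^ d"
      using n by (auto elim: is_nth_powerE)
    have root: "nth_root_nat d n = m"
      using m \<open>d \<ge> 2\<close> by simp
    have "m > 0"
      using m n(1) \<open>d \<ge> 2\<close> by (cases m) (auto simp: power_0_left)
    have ip: "independent_poisson_processes (M n) d (real m) (X n)"
      using assms(5)[OF n] root by simp
    interpret prob_space "M n"
      using ip by (simp add: independent_poisson_processes_def)
    define D where "D j k \<omega> = \<bar>line_algorithm ((1 - \<epsilon>) / real m) ((1 + \<tau>) / real m)
        (\<lambda>k. X n j k \<omega>) k - X n j k \<omega>\<bar> powr a" for j k \<omega>
    have D: "integrable (M n) (D j k)" "expectation (D j k) \<le> C * real m powr - a" if "j < d" for j k
    proof -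
      have "poisson_process (M n) (real m) (X n j)"
        using ip that by (simp add: independent_poisson_processes_def)
      note moment = poisson_displacement_moment[OF this _ \<open>a > 0\<close> c(1,2,4,5,3)]
      show "integrable (M n) (D j k)" "expectation (D j k) \<le> C * real m powr - a"
        unfolding D_def[abs_def] C_def using moment \<open>m > 0\<close> by simp_all
    qed
    have initial_placement: "initial_placement (X n) \<omega> i j = X n j (i j) \<omega>" for \<omega> i j
      by (simp add: initial_placement_def)
    have mov: "algorithm_movement d a \<epsilon> \<tau> n (X n) = (\<lambda>\<omega>. \<Sum>i\<in>sensors d m. \<Sum>j<d. D j (i j) \<omega>)"
      by (auto simp: fun_eq_iff algorithm_movement_def root Let_def total_movement_def D_def
          grid_algorithm_initial_placement initial_placement intro!: sum.cong)
    have "integral\<^sup>L (M n) (algorithm_movement d a \<epsilon> \<tau> n (X n))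
        = (\<Sum>i\<in>sensors d m. \<Sum>j<d. expectation (D j (i j)))"
      unfolding mov using D(1)
      by (subst Bochner_Integration.integral_sum)
        (auto intro!: Bochner_Integration.integrable_sum sum.cong Bochner_Integration.integral_sum)
    also have "\<dots> \<le> (\<Sum>i\<in>sensors d m. \<Sum>j<d. C * real m powr - a)"
      using D(2) by (intro sum_mono) auto
    also have "\<dots> = real d * C * (real m ^ d * real m powr - a)"
      by (simp add: sensors_def card_PiE)
    \<comment> \<open>Both sides are \<open>m powr (d - a)\<close>, because
      \<open>n = m ^ d\<close>.\<close>
    also have "real m ^ d * real m powr - a = real n powr (1 - a / real d)"
      using \<open>m > 0\<close> \<open>d \<ge> 2\<close>
      by (simp add: m powr_powr right_diff_distrib powr_diff powr_minus_divide flip: powr_realpow)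
    finally have "integral\<^sup>L (M n) (algorithm_movement d a \<epsilon> \<tau> n (X n))
        \<le> real d * C * real n powr (1 - a / real d)" .
    moreover have "integrable (M n) (algorithm_movement d a \<epsilon> \<tau> n (X n))"
      unfolding mov using D(1) by (intro Bochner_Integration.integrable_sum) auto
    moreover have "0 \<le> integral\<^sup>L (M n) (algorithm_movement d a \<epsilon> \<tau> n (X n))"
      unfolding mov by (intro integral_nonneg_AE AE_I2 sum_nonneg) (simp add: D_def)
    ultimately show ?thesis by blast
  qed
  \<comment> \<open>The perfect power 0 lies outside \<open>main\<close> and is discarded by taking
    \<open>n\<close> large.\<close>
  have "eventually (\<lambda>n. norm (integral\<^sup>L (M n) (algorithm_movement d a \<epsilon> \<tau> n (X n)))
      \<le> real d * C * norm (real n powr (1 - a / real d)))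
      (inf sequentially (principal {n. is_nth_power d n}))"
    unfolding eventually_inf_principal using eventually_gt_at_top[of 0]
    by eventually_elim (use main in auto)
  then show ?thesis
    using main by (blast intro: bigoI)
qed

end
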